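(* Let $I=[p,q)$ with $p<q$ be a half-closed interval of the real line and let $\mathcal{G}_I$ be the group of interval exchange transformations of $I$. The commutator group of $\mathcal{G}_I$ is a simple group.
   Context: An interval exchange transformation of $I=[p,q)$ is a bijection $f:I\to I$ for which there is a finite partition of $I$ into half-closed intervals $[p_{i-1},p_i)$, $p=p_0<p_1<\dots<p_k=q$, such that the restriction of $f$ to each of them is a translation. All such maps form a group $\mathcal{G}_I$ under composition. The commutator group of $\mathcal{G}_I$ is the subgroup generated by all commutators $f^{-1}g^{-1}fg$, $f,g\in\mathcal{G}_I$. *)

theory Defs
  imports Complex_Main "HOL-Algebra.Algebra"
begin

text \<open>Following \<^const>\<open>Bij\<close>, a self-map of \<open>{p..<q}\<close> is encoded as an extensional function,
  so that equality of maps is equality on \<open>{p..<q}\<close>.\<close>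

definition iet :: "real \<Rightarrow> real \<Rightarrow> (real \<Rightarrow> real) set" where
  "iet p q = {f \<in> Bij {p..<q}.
     \<exists>(k::nat) (x :: nat \<Rightarrow> real). x 0 = p \<and> x k = q \<and> (\<forall>i<k. x i < x (Suc i)) \<and>
       (\<forall>i<k. \<exists>c. \<forall>t\<in>{x i..<x (Suc i)}. f t = t + c)}"

definition iet_group :: "real \<Rightarrow> real \<Rightarrow> (real \<Rightarrow> real) monoid" where
  "iet_group p q = (BijGroup {p..<q})\<lparr>carrier := iet p q\<rparr>"

text \<open>\<^const>\<open>derived\<close> is generated by the commutators \<open>f g f\<inverse> g\<inverse>\<close>. Substituting inverses for
  \<open>f\<close> and \<open>g\<close> shows that these are the same elements as the commutators \<open>f\<inverse> g\<inverse> f g\<close>.\<close>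

definition commutator_group :: "('a, 'b) monoid_scheme \<Rightarrow> ('a, 'b) monoid_scheme" where
  "commutator_group G = G\<lparr>carrier := derived G (carrier G)\<rparr>"

text \<open>The locale \<^locale>\<open>simple_group\<close> expresses nontriviality as \<open>order G > 1\<close>. As the cardinality of an
  infinite set is \<open>0\<close>, it is never satisfied by an infinite group, so nontriviality is stated here
  in terms of the carrier.\<close>

definition is_simple :: "('a, 'b) monoid_scheme \<Rightarrow> bool" where
  "is_simple G \<longleftrightarrow> group G \<and> carrier G \<noteq> {\<one>\<^bsub>G\<^esub>} \<and>
     (\<forall>H. H \<lhd> G \<longrightarrow> H = carrier G \<or> H = {\<one>\<^bsub>G\<^esub>})"

end

theory Submission
  imports Defs
begin

text \<open>
  Write \<open>G\<close> for the group of interval exchanges, \<open>G'\<close> for its commutator group, \<open>[x, y]\<close> for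
  \<open>x y x\<inverse> y\<inverse>\<close>, and \<open>G\<^sub>J\<close> for the exchanges that fix every point outside \<open>J\<close>. Interval
  exchanges preserve length, so the usual device of shrinking a support is not available. What
  replaces it is fragmentation (\<open>short_supported_generate\<close>): for every \<open>\<delta> > 0\<close> the group \<open>G\<close> is
  generated by the \<open>G\<^sub>J\<close> with \<open>J\<close> an interval of length at most \<open>\<delta>\<close>. Indeed an exchange is a
  rearrangement of finitely many blocks, hence a product of swaps of two adjacent blocks, and
  swapping two long blocks amounts to successively swapping short pieces of them.

  The first consequence is \<open>G = G' G\<^sub>U\<close> for every nonempty interval \<open>U\<close>
  (\<open>derived_times_supported\<close>): modulo \<open>G'\<close> an element does not change under conjugation, and a
  generator with short support can be conjugated into \<open>G\<^sub>U\<close>. So any element of \<open>G\<close> can be corrected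
  to an element of \<open>G'\<close> at the expense of an arbitrarily small region of one's choice.

  Now let \<open>N\<close> be a nontrivial normal subgroup of \<open>G'\<close>. Some \<open>n \<in> N\<close> moves an interval \<open>K\<close> off
  itself; cut \<open>K\<close> into thirds \<open>K\<^sub>0\<close>, \<open>U\<close>, \<open>V\<close>. Take \<open>f, g\<close> in the group of \<open>K\<^sub>0\<close> and correct them in
  \<open>U\<close> and \<open>V\<close> to \<open>f', g' \<in> G'\<close>. The corrections commute with all that matters, so
  \<open>[f, g] = [f', g']\<close>. As \<open>n\<close> displaces the supports of \<open>f'\<close> and \<open>g'\<close>, this equals
  \<open>[[f', n], g']\<close>, which lies in \<open>N\<close>. Correcting a conjugating element \<open>h \<in> G\<close> within \<open>U \<union> V\<close>
  shows that \<open>h [f, g] h\<inverse> \<in> N\<close> as well, and moving a short interval into \<open>K\<^sub>0\<close> extends this to all \<open>f, g\<close>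
  supported in a common short interval. Finally \<open>G'\<close> is generated by the conjugates of commutators
  of generators. Two generators with very short supports either commute or are supported in a
  common short interval, hence \<open>G' \<subseteq> N\<close>.
\<close>

section \<open>Commutators in groups\<close>

definition commutator :: "('a, 'b) monoid_scheme \<Rightarrow> 'a \<Rightarrow> 'a \<Rightarrow> 'a" where
  "commutator G x y = x \<otimes>\<^bsub>G\<^esub> y \<otimes>\<^bsub>G\<^esub> inv\<^bsub>G\<^esub> x \<otimes>\<^bsub>G\<^esub> inv\<^bsub>G\<^esub> y"

context group
begin

lemma commutator_closed [simp]:
  "\<lbrakk>x \<in> carrier G; y \<in> carrier G\<rbrakk> \<Longrightarrow> commutator G x y \<in> carrier G"
  by (simp add: commutator_def)

lemma cancel_left_inv [simp]:
  assumes "x \<in> carrier G" "y \<in> carrier G"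
  shows "x \<otimes> (inv x \<otimes> y) = y" "inv x \<otimes> (x \<otimes> y) = y"
  using assms by (simp_all flip: m_assoc)

lemma inv_commutator:
  "\<lbrakk>x \<in> carrier G; y \<in> carrier G\<rbrakk> \<Longrightarrow> inv (commutator G x y) = commutator G y x"
  by (simp add: commutator_def inv_mult_group m_assoc)

lemma conj_commutator:
  "\<lbrakk>x \<in> carrier G; y \<in> carrier G; k \<in> carrier G\<rbrakk> \<Longrightarrow>
    k \<otimes> commutator G x y \<otimes> inv k = commutator G (k \<otimes> x \<otimes> inv k) (k \<otimes> y \<otimes> inv k)"
  by (simp add: commutator_def inv_mult_group m_assoc)

lemma commutator_eq_one:
  "\<lbrakk>x \<in> carrier G; y \<in> carrier G; x \<otimes> y = y \<otimes> x\<rbrakk> \<Longrightarrow> commutator G x y = \<one>"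
  by (simp add: commutator_def m_assoc)

text \<open>By these two rules, commutators do not notice corrections that are supported elsewhere.\<close>

lemma commutator_mult_left_commuting:
  assumes "x \<in> carrier G" "y \<in> carrier G" "z \<in> carrier G" "y \<otimes> z = z \<otimes> y"
  shows "commutator G (x \<otimes> y) z = commutator G x z"
proof -
  have "commutator G (x \<otimes> y) z = x \<otimes> (y \<otimes> z) \<otimes> inv y \<otimes> inv x \<otimes> inv z"
    using assms(1-3) by (simp add: commutator_def inv_mult_group m_assoc)
  also have "\<dots> = commutator G x z"
    unfolding assms(4) using assms(1-3) by (simp add: commutator_def m_assoc)
  finally show ?thesis .
qed

lemma commutator_mult_right_commuting:
  assumes "x \<in> carrier G" "y \<in> carrier G" "z \<in> carrier G" "z \<otimes> x = x \<otimes> z"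
  shows "commutator G x (y \<otimes> z) = commutator G x y"
  using commutator_mult_left_commuting[of y z x] assms
  by (metis inv_commutator m_closed)

lemma commutator_in_derived:
  "\<lbrakk>x \<in> carrier G; y \<in> carrier G\<rbrakk> \<Longrightarrow> commutator G x y \<in> derived G (carrier G)"
  unfolding derived_def commutator_def by (auto intro: generate.incl)

text \<open>This set is the preimage of the centralizer of the coset of \<open>a\<close> in the quotient by \<open>M\<close>.\<close>

lemma subgroup_commuting_mod_normal:
  assumes "M \<lhd> G" "a \<in> carrier G"
  shows "subgroup {b \<in> carrier G. commutator G a b \<in> M} G"
proof -
  interpret M: normal M G by fact
  show ?thesis
  proof (rule subgroupI)
    show "{b \<in> carrier G. commutator G a b \<in> M} \<noteq> {}"
      using assms(2) commutator_eq_one[of a \<one>] by (auto intro!: exI[of _ \<one>])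
  next
    fix b assume b: "b \<in> {b \<in> carrier G. commutator G a b \<in> M}"
    have "commutator G a (inv b) = inv b \<otimes> inv (commutator G a b) \<otimes> inv (inv b)"
      using b assms(2) by (simp add: commutator_def inv_mult_group m_assoc)
    then show "inv b \<in> {b \<in> carrier G. commutator G a b \<in> M}"
      using b by (simp add: M.inv_op_closed1)
  next
    fix b c assume bc: "b \<in> {b \<in> carrier G. commutator G a b \<in> M}"
      "c \<in> {b \<in> carrier G. commutator G a b \<in> M}"
    have "commutator G a (b \<otimes> c) = commutator G a b \<otimes> (b \<otimes> commutator G a c \<otimes> inv b)"
      using bc assms(2) by (simp add: inv_mult_group commutator_def m_assoc)
    then show "b \<otimes> c \<in> {b \<in> carrier G. commutator G a b \<in> M}"
      using bc by (simp add: M.inv_op_closed2)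
  qed auto
qed

text \<open>Let \<open>M\<close> be the largest normal subgroup of \<open>G\<close> that is contained in \<open>N\<close>. The hypothesis puts the
  commutators of generators into \<open>M\<close>, so the generators of the quotient by \<open>M\<close> commute with each
  other and the quotient is abelian.\<close>

lemma derived_subset_of_commutator_conjugates:
  assumes N: "subgroup N G"
    and gen: "generate G S = carrier G"
    and conj: "\<And>h x y. \<lbrakk>h \<in> carrier G; x \<in> S; y \<in> S\<rbrakk> \<Longrightarrow> h \<otimes> commutator G x y \<otimes> inv h \<in> N"
  shows "derived G (carrier G) \<subseteq> N"
proof -
  interpret N: subgroup N G by fact
  have S: "S \<subseteq> carrier G"
    unfolding gen[symmetric] by (auto intro: generate.incl)
  define M where "M = {m \<in> carrier G. \<forall>h\<in>carrier G. h \<otimes> m \<otimes> inv h \<in> N}"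
  have M: "M \<lhd> G"
    unfolding normal_inv_iff
  proof (intro conjI ballI)
    show "subgroup M G"
    proof (rule subgroupI)
      show "M \<noteq> {}"
        using N.one_closed by (auto simp: M_def intro!: exI[of _ \<one>])
    next
      fix m assume m: "m \<in> M"
      have "h \<otimes> inv m \<otimes> inv h = inv (h \<otimes> m \<otimes> inv h)" if "h \<in> carrier G" for h
        using m that by (simp add: M_def inv_mult_group m_assoc)
      then show "inv m \<in> M" using m by (simp add: M_def)
    next
      fix m m' assume m: "m \<in> M" "m' \<in> M"
      have "h \<otimes> (m \<otimes> m') \<otimes> inv h = (h \<otimes> m \<otimes> inv h) \<otimes> (h \<otimes> m' \<otimes> inv h)"
        if "h \<in> carrier G" for h
        using m that by (simp add: M_def inv_mult_group m_assoc)
      then show "m \<otimes> m' \<in> M" using m by (simp add: M_def)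
    qed (auto simp: M_def)
  next
    fix k m assume k: "k \<in> carrier G" and m: "m \<in> M"
    have "h \<otimes> (k \<otimes> m \<otimes> inv k) \<otimes> inv h = (h \<otimes> k) \<otimes> m \<otimes> inv (h \<otimes> k)"
      if "h \<in> carrier G" for h
      using m k that by (simp add: M_def inv_mult_group m_assoc)
    then show "k \<otimes> m \<otimes> inv k \<in> M" using m k by (simp add: M_def)
  qed
  then interpret M: normal M G .
  have step: "commutator G a b \<in> M"
    if a: "a \<in> carrier G" and S_a: "\<And>x. x \<in> S \<Longrightarrow> commutator G a x \<in> M" and b: "b \<in> carrier G"
    for a b
  proof -
    have "generate G S \<subseteq> {b \<in> carrier G. commutator G a b \<in> M}"
      using S S_a by (intro generate_subgroup_incl subgroup_commuting_mod_normal[OF M a]) auto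
    with b show ?thesis
      unfolding gen by blast
  qed
  have gens: "commutator G x b \<in> M" if x: "x \<in> S" and b: "b \<in> carrier G" for x b
  proof (rule step[OF _ _ b])
    show "x \<in> carrier G" using S x by blast
    show "commutator G x y \<in> M" if "y \<in> S" for y
    proof -
      have "y \<in> carrier G" using S that by blast
      with \<open>x \<in> carrier G\<close> show ?thesis
        unfolding M_def by (intro CollectI conjI ballI commutator_closed conj[OF _ x that])
    qed
  qed
  have "commutator G a b \<in> M" if a: "a \<in> carrier G" and b: "b \<in> carrier G" for a b
  proof (rule step[OF a _ b])
    fix x assume x: "x \<in> S"
    then have "x \<in> carrier G" using S by blast
    then have "commutator G a x = inv (commutator G x a)"
      using a by (simp add: inv_commutator)
    then show "commutator G a x \<in> M"
      using gens[OF x a] by simp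
  qed
  then have "derived_set G (carrier G) \<subseteq> M"
    unfolding commutator_def by blast
  then have "derived G (carrier G) \<subseteq> M"
    unfolding derived_def using M.subgroup_axioms by (rule generate_subgroup_incl)
  also have "M \<subseteq> N"
  proof
    fix m assume "m \<in> M"
    then have "m \<in> carrier G" "\<one> \<otimes> m \<otimes> inv \<one> \<in> N"
      unfolding M_def by blast+
    then show "m \<in> N" by simp
  qed
  finally show ?thesis .
qed

text \<open>With \<open>m = [f, n]\<close>, which is \<open>f\<close> times the conjugate of \<open>f\<inverse>\<close> by \<open>n\<close>, one gets
  \<open>[f, g] = [m, g]\<close> because that conjugate commutes with \<open>g\<close>. The right-hand side is a product of
  \<open>m \<in> N\<close> and a conjugate of \<open>m\<inverse>\<close> by \<open>g\<close>. For permutations, the commutation hypothesis holds when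
  \<open>n\<close> displaces a set supporting \<open>f\<close> and \<open>g\<close>.\<close>

lemma commutator_in_normal_of_displacement:
  assumes "D \<subseteq> carrier G" "subgroup N G"
    and conj: "\<And>x m. \<lbrakk>x \<in> D; m \<in> N\<rbrakk> \<Longrightarrow> x \<otimes> m \<otimes> inv x \<in> N"
    and "n \<in> N" "f \<in> D" "g \<in> D"
    and displaced: "(n \<otimes> inv f \<otimes> inv n) \<otimes> g = g \<otimes> (n \<otimes> inv f \<otimes> inv n)"
  shows "commutator G f g \<in> N"
proof -
  interpret N: subgroup N G by fact
  have carr: "f \<in> carrier G" "g \<in> carrier G" "n \<in> carrier G"
    using assms by auto
  define m where "m = f \<otimes> n \<otimes> inv f \<otimes> inv n"
  have m: "m \<in> N"
    unfolding m_def using assms by simp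
  have "commutator G f g = commutator G m g"
    using commutator_mult_left_commuting[of f "n \<otimes> inv f \<otimes> inv n" g] carr displaced
    by (simp add: m_def m_assoc)
  also have "\<dots> = m \<otimes> (g \<otimes> inv m \<otimes> inv g)"
    using m carr by (simp add: commutator_def m_assoc)
  finally show ?thesis
    using m assms by simp
qed

end

section \<open>Interval exchanges form a group\<close>

lemma chain_locate:
  fixes x :: "nat \<Rightarrow> real"
  assumes "x 0 \<le> t" "t < x k"
  shows "\<exists>i<k. x i \<le> t \<and> t < x (Suc i)"
  using assms
proof (induction k)
  case (Suc k)
  then show ?case
    by (cases "t < x k") (auto intro: less_SucI)
qed simp

text \<open>A finite set of possible breakpoints is easier to transform than an indexed partition: no
  ordering of the points has to be maintained when such sets are enlarged or moved. The gap is
  \<open>{s<..t}\<close> because the pieces are closed on the left, so that a break at \<open>d\<close> separates \<open>d\<close> from the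
  points before it.\<close>

lemma iet_iff_breakpoints:
  assumes "p < q"
  shows "f \<in> iet p q \<longleftrightarrow> f \<in> Bij {p..<q} \<and> (\<exists>D. finite D \<and>
    (\<forall>s t. p \<le> s \<and> s < t \<and> t < q \<and> D \<inter> {s<..t} = {} \<longrightarrow> f t - t = f s - s))"
    (is "_ \<longleftrightarrow> _ \<and> (\<exists>D. finite D \<and> ?const D)")
proof (intro iffI conjI)
  assume "f \<in> iet p q"
  then obtain k :: nat and x where f: "f \<in> Bij {p..<q}" and x: "x 0 = p" "x k = q"
    and tr: "\<And>i. i < k \<Longrightarrow> \<exists>c. \<forall>t\<in>{x i..<x (Suc i)}. f t = t + c"
    unfolding iet_def by blast
  show "f \<in> Bij {p..<q}" by fact
  have "?const (x ` {..k})"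
  proof (intro allI impI)
    fix s t assume st: "p \<le> s \<and> s < t \<and> t < q \<and> x ` {..k} \<inter> {s<..t} = {}"
    then obtain i where i: "i < k" "x i \<le> s" "s < x (Suc i)"
      using chain_locate[of x s k] x by auto
    then have "x (Suc i) \<notin> {s<..t}"
      using st by (metis IntI Suc_leI atMost_iff empty_iff imageI)
    then show "f t - t = f s - s"
      using tr[OF i(1)] i st by force
  qed
  then show "\<exists>D. finite D \<and> ?const D" by blast
next
  assume "f \<in> Bij {p..<q} \<and> (\<exists>D. finite D \<and> ?const D)"
  then obtain D where f: "f \<in> Bij {p..<q}" and "finite D" and D: "?const D" by blast
  define A where "A = insert p (insert q (D \<inter> {p<..<q}))"
  define xs where "xs = sorted_list_of_set A"
  define k where "k = length xs - 1"
  have "finite A" using \<open>finite D\<close> by (simp add: A_def)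
  then have xs: "set xs = A" "sorted_wrt (<) xs"
    by (simp_all add: xs_def)
  have "A \<noteq> {}" by (simp add: A_def)
  then have len: "length xs = Suc k"
    using xs(1) by (cases xs) (auto simp: k_def)
  have less: "xs ! i < xs ! j" if "i < j" "j \<le> k" for i j
    using sorted_wrt_nth_less[OF xs(2)] that len by simp
  have mem: "xs ! i \<in> A" if "i \<le> k" for i
    using nth_mem[of i xs] that len xs(1) by simp
  have idx: "\<exists>i\<le>k. xs ! i = a" if "a \<in> A" for a
    using that xs(1) len in_set_conv_nth[of a xs] by (metis less_Suc_eq_le)
  have le: "xs ! i \<le> xs ! j" if "i \<le> j" "j \<le> k" for i j
    using less[of i j] that by (cases "i = j") auto
  have bounds: "p \<le> a" "a \<le> q" if "a \<in> A" for a
    using that assms by (auto simp: A_def)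
  have "xs ! 0 = p"
  proof -
    obtain i where "i \<le> k" "xs ! i = p" using idx[of p] by (auto simp: A_def)
    then show ?thesis using le[of 0 i] bounds(1)[OF mem[of 0]] by simp
  qed
  moreover have "xs ! k = q"
  proof -
    obtain i where "i \<le> k" "xs ! i = q" using idx[of q] by (auto simp: A_def)
    then show ?thesis using le[of i k] bounds(2)[OF mem[of k]] by simp
  qed
  moreover have "\<exists>c. \<forall>t\<in>{xs ! i..<xs ! Suc i}. f t = t + c" if i: "i < k" for i
  proof -
    have gap: "D \<inter> {xs ! i<..<xs ! Suc i} = {}"
    proof (rule ccontr)
      assume "\<not> ?thesis"
      then obtain d where d: "d \<in> D" "xs ! i < d" "d < xs ! Suc i" by auto
      then have "d \<in> A"
        using bounds mem[of i] mem[of "Suc i"] i by (fastforce simp: A_def)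
      then obtain j where "j \<le> k" "xs ! j = d" using idx by blast
      then show False
        using d le[of "Suc i" j] le[of j i] i by (cases "j \<le> i") auto
    qed
    have "f t = t + (f (xs ! i) - xs ! i)" if t: "t \<in> {xs ! i..<xs ! Suc i}" for t
    proof (cases "t = xs ! i")
      case False
      have "D \<inter> {xs ! i<..t} = {}" using gap t by force
      moreover have "p \<le> xs ! i" "t < q"
        using bounds mem[of i] mem[of "Suc i"] i t by force+
      ultimately have "f t - t = f (xs ! i) - xs ! i"
        using D t False by simp
      then show ?thesis by simp
    qed simp
    then show ?thesis by blast
  qed
  ultimately show "f \<in> iet p q"
    unfolding iet_def using f less by (intro CollectI conjI exI[of _ k] exI[of _ "(!) xs"]) auto
qed

text \<open>A composition \<open>f \<circ> g\<close> breaks only where \<open>g\<close> does or where \<open>g\<close> takes a breakpoint of \<open>f\<close> as value.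
  The pieces of an inverse are the images of the pieces, so the inverse breaks only at the images of
  left endpoints of pieces; \<open>p\<close> has to be counted among these.\<close>

lemma subgroup_iet:
  assumes "p < q"
  shows "subgroup (iet p q) (BijGroup {p..<q})"
proof -
  interpret B: group "BijGroup {p..<q}" by (rule group_BijGroup)
  have Bij: "f \<in> Bij {p..<q}" if "f \<in> iet p q" for f
    using that by (simp add: iet_def)
  show ?thesis
  proof (rule B.subgroupI)
    show "iet p q \<subseteq> carrier (BijGroup {p..<q})"
      using Bij by (auto simp: BijGroup_def)
    have "(\<lambda>t\<in>{p..<q}. t) \<in> iet p q"
      unfolding iet_iff_breakpoints[OF assms] using id_Bij by auto
    then show "iet p q \<noteq> {}" by auto
  next
    fix f assume f: "f \<in> iet p q"
    then obtain D where "finite D" and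
      D: "\<And>s t. p \<le> s \<Longrightarrow> s < t \<Longrightarrow> t < q \<Longrightarrow> D \<inter> {s<..t} = {} \<Longrightarrow> f t - t = f s - s"
      unfolding iet_iff_breakpoints[OF assms] by blast
    define h where "h = (\<lambda>t\<in>{p..<q}. inv_into {p..<q} f t)"
    have bij: "bij_betw f {p..<q} {p..<q}"
      using Bij[OF f] by (simp add: Bij_def)
    have h: "h t \<in> {p..<q}" "f (h t) = t" if "t \<in> {p..<q}" for t
      using that Bij_inv_into_mem[OF Bij[OF f]] bij_betw_inv_into_right[OF bij]
      by (simp_all add: h_def)
    have hf: "h (f t) = t" if "t \<in> {p..<q}" for t
      using that bij_betwE[OF bij] bij_betw_inv_into_left[OF bij] by (simp add: h_def)
    define D' where "D' = insert p (D \<inter> {p..<q})"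
    have "finite D'" using \<open>finite D\<close> by (simp add: D'_def)
    have "h t - t = h s - s" if st: "p \<le> s" "s < t" "t < q" and gap: "f ` D' \<inter> {s<..t} = {}" for s t
    proof -
      have ht: "h t \<in> {p..<q}" "f (h t) = t" using h st by auto
      \<comment> \<open>the left endpoint of the piece of \<open>f\<close> that contains \<open>h t\<close>\<close>
      define d where "d = Max (D' \<inter> {..h t})"
      have "p \<in> D' \<inter> {..h t}" using ht by (simp add: D'_def)
      then have ne: "D' \<inter> {..h t} \<noteq> {}" by blast
      have d: "d \<in> D'" "d \<le> h t"
        using Max_in[OF _ ne] \<open>finite D'\<close> by (auto simp: d_def)
      have pd: "p \<le> d" using d assms by (auto simp: D'_def)
      have max: "e \<le> d" if "e \<in> D'" "e \<le> h t" for e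
        using that \<open>finite D'\<close> by (simp add: d_def)
      have tr: "f u = u + (f d - d)" if u: "d \<le> u" "u \<le> h t" for u
      proof (cases "u = d")
        case False
        have "D \<inter> {d<..u} = {}"
          using max u ht pd by (fastforce simp: D'_def)
        then show ?thesis using D[of d u] u False pd ht by auto
      qed simp
      have "f d \<notin> {s<..t}" using gap d(1) by blast
      moreover have "f d \<le> t" using tr[of "h t"] d ht by simp
      ultimately have "f d \<le> s" using st by simp
      then have "f (s - (f d - d)) = s"
        using tr[of "s - (f d - d)"] tr[of "h t"] d ht st by simp
      moreover have "s - (f d - d) \<in> {p..<q}"
        using \<open>f d \<le> s\<close> tr[of "h t"] d ht st pd by simp
      ultimately have "h s = s - (f d - d)" using hf by metis
      then show ?thesis using tr[of "h t"] d ht by simp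
    qed
    then have "h \<in> iet p q"
      unfolding iet_iff_breakpoints[OF assms]
      using restrict_inv_into_Bij[OF Bij[OF f], folded h_def] \<open>finite D'\<close>
      by (intro conjI exI[of _ "f ` D'"]) auto
    then show "inv\<^bsub>BijGroup {p..<q}\<^esub> f \<in> iet p q"
      using inv_BijGroup[OF Bij[OF f]] by (simp add: h_def)
  next
    fix f g assume f: "f \<in> iet p q" and g: "g \<in> iet p q"
    obtain Df where "finite Df" and
      Df: "\<And>s t. p \<le> s \<Longrightarrow> s < t \<Longrightarrow> t < q \<Longrightarrow> Df \<inter> {s<..t} = {} \<Longrightarrow> f t - t = f s - s"
      using f unfolding iet_iff_breakpoints[OF assms] by blast
    obtain Dg where "finite Dg" and
      Dg: "\<And>s t. p \<le> s \<Longrightarrow> s < t \<Longrightarrow> t < q \<Longrightarrow> Dg \<inter> {s<..t} = {} \<Longrightarrow> g t - t = g s - s"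
      using g unfolding iet_iff_breakpoints[OF assms] by blast
    have bij: "bij_betw g {p..<q} {p..<q}"
      using Bij[OF g] by (simp add: Bij_def)
    define D where "D = Dg \<union> {u \<in> {p..<q}. g u \<in> Df}"
    have "finite {u \<in> {p..<q}. g u \<in> Df}"
      using finite_vimage_IntI[OF \<open>finite Df\<close> bij_betw_imp_inj_on[OF bij]]
      by (rule rev_finite_subset) auto
    then have "finite D" using \<open>finite Dg\<close> by (simp add: D_def)
    have "compose {p..<q} f g t - t = compose {p..<q} f g s - s"
      if st: "p \<le> s" "s < t" "t < q" and gap: "D \<inter> {s<..t} = {}" for s t
    proof -
      have tr: "g u = u + (g s - s)" if "s \<le> u" "u \<le> t" for u
        using Dg[of s u] that st gap by (cases "u = s") (force simp: D_def)+
      have gst: "p \<le> g s" "g t < q"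
        using bij_betwE[OF bij] st by force+
      have "Df \<inter> {g s<..g t} = {}"
      proof (rule ccontr)
        assume "\<not> ?thesis"
        then obtain d where d: "d \<in> Df" "g s < d" "d \<le> g t" by auto
        define u where "u = d - (g s - s)"
        have u: "s < u" "u \<le> t" using d tr[of t] st by (auto simp: u_def)
        then have "g u = d" using tr[of u] by (simp add: u_def)
        then have "u \<in> D" using d u st by (simp add: D_def)
        then show False using gap u by auto
      qed
      then have "f (g t) - g t = f (g s) - g s"
        using Df[of "g s" "g t"] gst tr[of t] st by simp
      then show ?thesis using tr[of t] st by (simp add: compose_def)
    qed
    then have "compose {p..<q} f g \<in> iet p q"
      unfolding iet_iff_breakpoints[OF assms]
      using compose_Bij[OF Bij[OF f] Bij[OF g]] \<open>finite D\<close> by blast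
    then show "f \<otimes>\<^bsub>BijGroup {p..<q}\<^esub> g \<in> iet p q"
      using Bij f g by (simp add: BijGroup_def)
  qed
qed

lemma ietE:
  assumes "f \<in> iet p q"
  obtains k :: nat and x :: "nat \<Rightarrow> real" where
    "x 0 = p" "x k = q" "\<And>i. i < k \<Longrightarrow> x i < x (Suc i)"
    "\<And>i j. \<lbrakk>i \<le> j; j \<le> k\<rbrakk> \<Longrightarrow> x i \<le> x j"
    "\<And>i. i < k \<Longrightarrow> \<exists>c. \<forall>t\<in>{x i..<x (Suc i)}. f t = t + c"
proof -
  from assms obtain k :: nat and x where x: "x 0 = p" "x k = q" "\<And>i. i < k \<Longrightarrow> x i < x (Suc i)"
    "\<And>i. i < k \<Longrightarrow> \<exists>c. \<forall>t\<in>{x i..<x (Suc i)}. f t = t + c"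
    unfolding iet_def by blast
  have mono: "x i \<le> x j" if "i \<le> j" "j \<le> k" for i j
    using that
  proof (induction j rule: dec_induct)
    case (step j)
    then show ?case using x(3)[of j] by force
  qed simp
  show thesis
    by (rule that[OF x(1,2,3) mono x(4)])
qed

section \<open>Supports\<close>

locale interval_exchange = group G for G :: "(real \<Rightarrow> real) monoid" (structure) +
  fixes p q :: real
  assumes p_less_q: "p < q" and G_eq: "G = iet_group p q"
begin

lemma carrier_iff: "f \<in> carrier G \<longleftrightarrow> f \<in> iet p q"
  by (simp add: G_eq iet_group_def)

lemma carrier_Bij: "f \<in> carrier G \<Longrightarrow> f \<in> Bij {p..<q}"
  by (simp add: carrier_iff iet_def)

lemma apply_mem: "\<lbrakk>f \<in> carrier G; t \<in> {p..<q}\<rbrakk> \<Longrightarrow> f t \<in> {p..<q}"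
  using carrier_Bij Bij_imp_funcset by blast

lemma mult_apply: "\<lbrakk>f \<in> carrier G; g \<in> carrier G; t \<in> {p..<q}\<rbrakk> \<Longrightarrow> (f \<otimes> g) t = f (g t)"
  using carrier_Bij[of f] carrier_Bij[of g]
  by (simp add: G_eq iet_group_def BijGroup_def compose_def)

lemma one_apply: "t \<in> {p..<q} \<Longrightarrow> \<one> t = t"
  by (simp add: G_eq iet_group_def BijGroup_def)

lemma inv_apply:
  assumes "f \<in> carrier G" "t \<in> {p..<q}"
  shows "(inv f) (f t) = t" "f ((inv f) t) = t"
  using assms mult_apply[of "inv f" f t] mult_apply[of f "inv f" t] by (simp_all add: one_apply)

lemma carrier_eqI:
  assumes "f \<in> carrier G" "g \<in> carrier G" "\<And>t. t \<in> {p..<q} \<Longrightarrow> f t = g t"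
  shows "f = g"
  by (rule extensionalityI[of _ "{p..<q}"]) (use assms carrier_Bij Bij_imp_extensional in blast)+

definition supported :: "real set \<Rightarrow> (real \<Rightarrow> real) set" where
  "supported J = {f \<in> carrier G. \<forall>t\<in>{p..<q} - J. f t = t}"

lemma supported_carrier: "f \<in> supported J \<Longrightarrow> f \<in> carrier G"
  by (simp add: supported_def)

lemma supported_mono: "\<lbrakk>f \<in> supported J; J \<subseteq> K\<rbrakk> \<Longrightarrow> f \<in> supported K"
  by (auto simp: supported_def)

lemma subgroup_supported: "subgroup (supported J) G"
proof (rule subgroupI)
  show "supported J \<noteq> {}"
    by (auto simp: supported_def one_apply intro!: exI[of _ \<one>])
  show "inv f \<in> supported J" if "f \<in> supported J" for f
    using that inv_apply(1)[of f] by (fastforce simp: supported_def)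
  show "f \<otimes> g \<in> supported J" if "f \<in> supported J" "g \<in> supported J" for f g
    using that by (auto simp: supported_def mult_apply)
qed (auto simp: supported_def)

lemma supported_preserves:
  assumes "f \<in> supported J" "t \<in> {p..<q}" "t \<in> J"
  shows "f t \<in> J"
proof (rule ccontr)
  assume "f t \<notin> J"
  then have "f (f t) = f t"
    using assms apply_mem by (simp add: supported_def)
  then have "f t = t"
    using assms inv_apply(1) apply_mem supported_carrier by metis
  with assms \<open>f t \<notin> J\<close> show False by simp
qed

lemma supported_disjoint_commute:
  assumes f: "f \<in> supported J" and g: "g \<in> supported K" and disj: "J \<inter> K = {}"
  shows "f \<otimes> g = g \<otimes> f"
proof (rule carrier_eqI)
  have carr: "f \<in> carrier G" "g \<in> carrier G"
    using f g supported_carrier by auto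
  then show "f \<otimes> g \<in> carrier G" "g \<otimes> f \<in> carrier G" by auto
  fix t assume t: "t \<in> {p..<q}"
  have fix_f: "f s = s" if "s \<in> {p..<q}" "s \<notin> J" for s
    using f that by (simp add: supported_def)
  have fix_g: "g s = s" if "s \<in> {p..<q}" "s \<notin> K" for s
    using g that by (simp add: supported_def)
  have "f (g t) = g (f t)"
  proof (cases "t \<in> J")
    case True
    then have "t \<notin> K" "f t \<notin> K"
      using supported_preserves[OF f t] disj by auto
    then show ?thesis
      using apply_mem[OF carr(1) t] fix_g t by simp
  next
    case False
    show ?thesis
    proof (cases "t \<in> K")
      case True
      then have "g t \<notin> J"
        using supported_preserves[OF g t] disj by auto
      then show ?thesis
        using apply_mem[OF carr(2) t] fix_f t False by simp
    qed (use False fix_f fix_g t in auto)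
  qed
  then show "(f \<otimes> g) t = (g \<otimes> f) t"
    using carr t by (simp add: mult_apply)
qed

lemma supported_conj:
  assumes "f \<in> supported J" "k \<in> carrier G" "k ` (J \<inter> {p..<q}) \<subseteq> U"
  shows "k \<otimes> f \<otimes> inv k \<in> supported U"
proof -
  have f: "f \<in> carrier G" by (rule supported_carrier) fact
  have "(k \<otimes> f \<otimes> inv k) t = t" if t: "t \<in> {p..<q}" "t \<notin> U" for t
  proof -
    have s: "(inv k) t \<in> {p..<q}" "k ((inv k) t) = t"
      using apply_mem[of "inv k"] inv_apply(2) assms(2) t by auto
    then have "(inv k) t \<notin> J"
      using t(2) assms(3) by force
    then have "f ((inv k) t) = (inv k) t"
      using assms(1) s by (simp add: supported_def)
    then show ?thesis
      using s t f assms(2) by (simp add: mult_apply)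
  qed
  then show ?thesis
    using f assms(2) by (simp add: supported_def)
qed

section \<open>Exchanges of two adjacent blocks generate\<close>

definition exchange :: "real \<Rightarrow> real \<Rightarrow> real \<Rightarrow> real \<Rightarrow> real" where
  "exchange a b c = (\<lambda>t\<in>{p..<q}.
     if t \<in> {a..<b} then t + (c - b) else if t \<in> {b..<c} then t - (b - a) else t)"

lemma exchange_carrier:
  assumes "p \<le> a" "a \<le> b" "b \<le> c" "c \<le> q"
  shows "exchange a b c \<in> carrier G"
proof -
  have "bij_betw (exchange a b c) {p..<q} {p..<q}"
    by (rule bij_betw_byWitness[where f' = "exchange a (a + c - b) c"])
      (use assms in \<open>auto simp: exchange_def\<close>)
  then have "exchange a b c \<in> Bij {p..<q}"
    by (simp add: Bij_def exchange_def)
  moreover have "exchange a b c t - t = exchange a b c s - s"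
    if "p \<le> s" "s < t" "t < q" "{a, b, c} \<inter> {s<..t} = {}" for s t
    using that assms by (auto simp: exchange_def)
  ultimately show ?thesis
    unfolding carrier_iff iet_iff_breakpoints[OF p_less_q]
    by (intro conjI exI[of _ "{a, b, c}"]) auto
qed

lemma exchange_supported:
  "\<lbrakk>p \<le> a; a \<le> b; b \<le> c; c \<le> q\<rbrakk> \<Longrightarrow> exchange a b c \<in> supported {a..<c}"
  using exchange_carrier by (auto simp: supported_def exchange_def)

lemma inv_exchange:
  assumes "p \<le> a" "a \<le> b" "b \<le> c" "c \<le> q"
  shows "inv (exchange a (a + c - b) c) = exchange a b c"
proof (rule inv_equality)
  have carr: "exchange a b c \<in> carrier G" "exchange a (a + c - b) c \<in> carrier G"
    using assms exchange_carrier by auto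
  show "exchange a b c \<otimes> exchange a (a + c - b) c = \<one>"
    using assms carr
    by (intro carrier_eqI) (auto simp: mult_apply one_apply, auto simp: exchange_def)
qed (use assms exchange_carrier in auto)

text \<open>Moving the block \<open>{a..<b}\<close> past \<open>{b..<c}\<close> can be done in two stages: first past \<open>{b..<m}\<close>, which
  leaves the block at \<open>{a + m - b..<m}\<close>, and then past \<open>{m..<c}\<close>.\<close>

lemma exchange_split:
  assumes "p \<le> a" "a \<le> b" "b \<le> m" "m \<le> c" "c \<le> q"
  shows "exchange a b c = exchange (a + m - b) m c \<otimes> exchange a b m"
proof -
  have carr: "exchange a b c \<in> carrier G" "exchange (a + m - b) m c \<in> carrier G"
    "exchange a b m \<in> carrier G"
    using assms by (auto intro!: exchange_carrier)
  show ?thesis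
    using assms carr
    by (intro carrier_eqI) (auto simp: mult_apply, auto simp: exchange_def)
qed

text \<open>The second block is cut into pieces of length at most \<open>e\<close>. The bound \<open>d\<close> on the first block is
  kept through the argument, so the lemma can be applied once to each block: the two blocks trade
  places under inversion.\<close>

lemma exchange_cut_second_block:
  assumes H: "subgroup H G" and "0 < e"
    and short: "\<And>a b c. \<lbrakk>p \<le> a; a \<le> b; b \<le> c; c \<le> q; b - a \<le> d; c - b \<le> e\<rbrakk> \<Longrightarrow> exchange a b c \<in> H"
    and "p \<le> a" "a \<le> b" "b \<le> c" "c \<le> q" "b - a \<le> d"
  shows "exchange a b c \<in> H"
proof -
  interpret H: subgroup H G by fact
  have "exchange a b c \<in> H" if "b \<le> c" "c \<le> q" "c - b \<le> real n * e" for n c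
    using that
  proof (induction n arbitrary: c)
    case 0
    then show ?case using short assms by simp
  next
    case (Suc n)
    show ?case
    proof (cases "c - b \<le> e")
      case True
      then show ?thesis using short Suc.prems assms by blast
    next
      case False
      have "exchange a b (c - e) \<in> H"
        using Suc False \<open>0 < e\<close> by (intro Suc.IH) (auto simp: algebra_simps)
      moreover have "exchange (a + (c - e) - b) (c - e) c \<in> H"
        using Suc.prems False assms by (intro short) auto
      moreover have "exchange a b c = exchange (a + (c - e) - b) (c - e) c \<otimes> exchange a b (c - e)"
        using Suc.prems False assms by (intro exchange_split) auto
      ultimately show ?thesis by simp
    qed
  qed
  moreover obtain n where "c - b \<le> real n * e"
    using ex_less_of_nat_mult[OF \<open>0 < e\<close>, of "c - b"] less_imp_le by blast
  ultimately show ?thesis using assms by blast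
qed

text \<open>The map \<open>f\<close> is sorted by composing with exchanges on the left. When all points before the \<open>i\<close>th
  piece \<open>{a..<a + l}\<close> are back in place, the image of that piece is \<open>{b..<b + l}\<close> for some
  \<open>b \<ge> a\<close>, and swapping it with \<open>{a..<b}\<close> brings it back. This exchange breaks only at the ends of
  the image of that piece and at the end \<open>a\<close> of the region already in place, so it never cuts the
  image of a later piece. The partition of \<open>f\<close> therefore serves for all stages and no new
  breakpoints have to be counted.\<close>

lemma exchanges_generate:
  assumes H: "subgroup H G"
    and exch: "\<And>a b c. \<lbrakk>p \<le> a; a \<le> b; b \<le> c; c \<le> q\<rbrakk> \<Longrightarrow> exchange a b c \<in> H"
  shows "carrier G = H"
proof
  interpret H: subgroup H G by fact
  show "H \<subseteq> carrier G" by (rule H.subset)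
  show "carrier G \<subseteq> H"
  proof
    fix f assume f: "f \<in> carrier G"
    then obtain k :: nat and x where x0: "x 0 = p" and xk: "x k = q"
      and less: "\<And>i. i < k \<Longrightarrow> x i < x (Suc i)"
      and mono: "\<And>i j. \<lbrakk>i \<le> j; j \<le> k\<rbrakk> \<Longrightarrow> x i \<le> x j"
      and tr: "\<And>i. i < k \<Longrightarrow> \<exists>c. \<forall>t\<in>{x i..<x (Suc i)}. f t = t + c"
      unfolding carrier_iff by (rule ietE) blast
    have "\<exists>g\<in>H. (\<forall>t\<in>{p..<x i}. g (f t) = t) \<and>
        (\<forall>j. i \<le> j \<and> j < k \<longrightarrow> (\<exists>c. \<forall>t\<in>{x j..<x (Suc j)}. g (f t) = t + c))"
      if "i \<le> k" for i
      using that
    proof (induction i)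
      case 0
      have "\<forall>j<k. \<exists>c. \<forall>t\<in>{x j..<x (Suc j)}. \<one> (f t) = t + c"
      proof (intro allI impI)
        fix j assume j: "j < k"
        have "{x j..<x (Suc j)} \<subseteq> {p..<q}"
          using mono[of 0 j] mono[of "Suc j" k] j x0 xk by auto
        then have "\<forall>t\<in>{x j..<x (Suc j)}. \<one> (f t) = f t"
          using one_apply apply_mem[OF f] by blast
        with tr[OF j] show "\<exists>c. \<forall>t\<in>{x j..<x (Suc j)}. \<one> (f t) = t + c" by simp
      qed
      then show ?case using x0 by (intro bexI[of _ \<one>]) auto
    next
      case (Suc i)
      then obtain g where g: "g \<in> H" and gid: "\<And>t. t \<in> {p..<x i} \<Longrightarrow> g (f t) = t"
        and gtr: "\<And>j. \<lbrakk>i \<le> j; j < k\<rbrakk> \<Longrightarrow> \<exists>c. \<forall>t\<in>{x j..<x (Suc j)}. g (f t) = t + c"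
        by auto
      have ik: "i < k" using Suc.prems by simp
      define h where "h = g \<otimes> f"
      have h: "h \<in> carrier G" using g f by (simp add: h_def)
      have hI: "h t = g (f t)" if "t \<in> {p..<q}" for t
        using that g f by (simp add: h_def mult_apply)
      have in_I: "{x j..<x (Suc j)} \<subseteq> {p..<q}" if "j < k" for j
        using mono[of 0 j] mono[of "Suc j" k] that x0 xk by auto
      have h_inj: "s = t" if "h s = h t" "s \<in> {p..<q}" "t \<in> {p..<q}" for s t
        using that inv_apply(1)[OF h] by metis
      have hid: "h t = t" if "t \<in> {p..<x i}" for t
        using gid[OF that] hI that mono[of i k] ik xk by simp
      define a where "a = x i"
      define l where "l = x (Suc i) - x i"
      have a: "p \<le> a" "a < q" "a + l \<le> q" "0 < l"
        using mono[of 0 i] mono[of "Suc i" k] less[of i] ik x0 xk by (auto simp: a_def l_def)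
      obtain c where c: "\<And>t. t \<in> {a..<a + l} \<Longrightarrow> g (f t) = t + c"
        using gtr[of i] ik by (auto simp: a_def l_def)
      then have hc: "h t = t + c" if "t \<in> {a..<a + l}" for t
        using that hI a by simp
      define b where "b = a + c"
      \<comment> \<open>The points before \<open>a\<close> are fixed, so by injectivity all others stay at or after \<open>a\<close>.\<close>
      have h_ge: "a \<le> h t" if "t \<in> {a..<q}" for t
      proof (rule ccontr)
        assume lt: "\<not> a \<le> h t"
        then have "h t \<in> {p..<x i}" using apply_mem[OF h, of t] that a by (auto simp: a_def)
        then have "h (h t) = h t" by (rule hid)
        then show False using h_inj[of "h t" t] apply_mem[OF h, of t] that a lt by auto
      qed
      have "a \<le> b" using h_ge[of a] hc[of a] a by (simp add: b_def)
      have "b + l \<le> q"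
      proof (rule ccontr)
        assume "\<not> ?thesis"
        \<comment> \<open>the first point of the piece whose translate would not lie before \<open>q\<close>\<close>
        then have "max a (q - c) \<in> {a..<a + l}" using a by (auto simp: b_def)
        moreover from this have "h (max a (q - c)) < q"
          using apply_mem[OF h, of "max a (q - c)"] a by auto
        ultimately show False using hc[of "max a (q - c)"] by auto
      qed
      define E where "E = exchange a b (b + l)"
      have E: "E \<in> H"
        unfolding E_def using a \<open>a \<le> b\<close> \<open>b + l \<le> q\<close> by (intro exch) auto
      have Eap: "E t = (if t \<in> {a..<b} then t + l else if t \<in> {b..<b + l} then t - (b - a) else t)"
        if "t \<in> {p..<q}" for t
        using that by (simp add: E_def exchange_def)
      have Eg: "(E \<otimes> g) (f t) = E (h t)" if "t \<in> {p..<q}" for t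
        using that E g f hI apply_mem[OF f] by (simp add: mult_apply)
      have "(E \<otimes> g) (f t) = t" if t: "t \<in> {p..<x (Suc i)}" for t
      proof -
        have tI: "t \<in> {p..<q}" using t a by (auto simp: l_def a_def)
        show ?thesis
        proof (cases "t < a")
          case True
          then show ?thesis
            using Eg[OF tI] hid[of t] Eap[OF tI] t \<open>a \<le> b\<close> by (auto simp: a_def)
        next
          case False
          then have tp: "t \<in> {a..<a + l}" using t by (simp add: a_def l_def)
          then show ?thesis
            using Eg[OF tI] hc[OF tp] Eap[OF apply_mem[OF h tI]] by (auto simp: b_def)
        qed
      qed
      moreover have "\<exists>d. \<forall>t\<in>{x j..<x (Suc j)}. (E \<otimes> g) (f t) = t + d"
        if j: "Suc i \<le> j" "j < k" for j
      proof -
        obtain d where "\<And>t. t \<in> {x j..<x (Suc j)} \<Longrightarrow> g (f t) = t + d"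
          using gtr[of j] j by auto
        then have d: "h t = t + d" if "t \<in> {x j..<x (Suc j)}" for t
          using that hI in_I[OF j(2)] by auto
        have xj: "a + l \<le> x j" "x (Suc j) \<le> q" "x j < x (Suc j)"
          using mono[of "Suc i" j] mono[of "Suc j" k] less[of j] j xk by (auto simp: a_def l_def)
        have avoid: "h t \<notin> {b..<b + l}" if t: "t \<in> {x j..<x (Suc j)}" for t
        proof
          assume ht: "h t \<in> {b..<b + l}"
          then have s: "h t - c \<in> {a..<a + l}" by (auto simp: b_def)
          then have "h (h t - c) = h t" using hc by force
          then have "h t - c = t"
            using h_inj[of "h t - c" t] s t xj a by auto
          then show False using s t xj by auto
        qed
        have pos: "h t \<in> {a..<q}" if "t \<in> {x j..<x (Suc j)}" for t
          using h_ge[of t] apply_mem[OF h, of t] that xj a by auto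
        \<comment> \<open>The image of a piece is an interval missing \<open>{b..<b + l}\<close>, so it lies entirely on one
          side of it and the exchange translates it as a whole.\<close>
        have side: "h t < b \<longleftrightarrow> x j + d < b" if t: "t \<in> {x j..<x (Suc j)}" for t
        proof (rule ccontr)
          assume "\<not> ?thesis"
          then have "x j + d < b" "b \<le> t + d" using d[OF t] t by auto
          then have bd: "b - d \<in> {x j..<x (Suc j)}" using t by auto
          then show False using avoid[OF bd] d[OF bd] a by simp
        qed
        have "(E \<otimes> g) (f t) = t + (if x j + d < b then d + l else d)"
          if t: "t \<in> {x j..<x (Suc j)}" for t
        proof -
          have "t \<in> {p..<q}" using in_I[OF j(2)] t by blast
          then show ?thesis
            using Eg Eap[of "h t"] apply_mem[OF h, of t] pos[OF t] avoid[OF t] side[OF t] d[OF t]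
            by auto
        qed
        then show ?thesis by blast
      qed
      moreover have "E \<otimes> g \<in> H" using E g by simp
      ultimately show ?case by (intro bexI[of _ "E \<otimes> g"]) auto
    qed
    from this[of k] obtain g where g: "g \<in> H" and "\<And>t. t \<in> {p..<q} \<Longrightarrow> g (f t) = t"
      using xk by auto
    then have "g \<otimes> f = \<one>"
      using f by (intro carrier_eqI) (auto simp: mult_apply one_apply)
    then have "inv f = g"
      using g f by (intro inv_equality) auto
    then have "f = inv g" using f by auto
    then show "f \<in> H" using g by simp
  qed
qed

section \<open>Fragmentation and correction\<close>

definition short_supported :: "real \<Rightarrow> (real \<Rightarrow> real) set" where
  "short_supported \<delta> = (\<Union>(a, b)\<in>{(a, b). p \<le> a \<and> a \<le> b \<and> b \<le> q \<and> b - a \<le> \<delta>}. supported {a..<b})"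

lemma short_supported_carrier: "short_supported \<delta> \<subseteq> carrier G"
  by (auto simp: short_supported_def supported_carrier)

text \<open>An exchange of two blocks of length at most \<open>\<delta> / 2\<close> is supported in an interval of length at most
  \<open>\<delta>\<close>. Arbitrary blocks are cut down to this size one after the other.\<close>

lemma short_supported_generate:
  assumes "0 < \<delta>"
  shows "generate G (short_supported \<delta>) = carrier G"
proof -
  let ?H = "generate G (short_supported \<delta>)"
  have H: "subgroup ?H G"
    by (rule generate_is_subgroup[OF short_supported_carrier])
  then interpret H: subgroup ?H G .
  have both_short: "exchange a b c \<in> ?H"
    if "p \<le> a" "a \<le> b" "b \<le> c" "c \<le> q" "b - a \<le> \<delta> / 2" "c - b \<le> \<delta> / 2" for a b c
  proof (rule generate.incl)
    have "c - a \<le> \<delta>" using that by simp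
    then show "exchange a b c \<in> short_supported \<delta>"
      using exchange_supported[of a b c] that unfolding short_supported_def
      by (intro UN_I[of "(a, c)"]) auto
  qed
  have first_short: "exchange a b c \<in> ?H"
    if "p \<le> a" "a \<le> b" "b \<le> c" "c \<le> q" "b - a \<le> \<delta> / 2" for a b c
    by (rule exchange_cut_second_block[OF H, where e = "\<delta> / 2" and d = "\<delta> / 2"])
      (use both_short assms that in auto)
  have second_short: "exchange a b c \<in> ?H"
    if "p \<le> a" "a \<le> b" "b \<le> c" "c \<le> q" "c - b \<le> \<delta> / 2" for a b c
  proof -
    have "exchange a (a + c - b) c \<in> ?H"
      using that by (intro first_short) auto
    then have "inv (exchange a (a + c - b) c) \<in> ?H" by simp
    then show ?thesis
      using inv_exchange[of a b c] that by simp
  qed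
  have "exchange a b c \<in> ?H" if "p \<le> a" "a \<le> b" "b \<le> c" "c \<le> q" for a b c
    by (rule exchange_cut_second_block[OF H, where e = "\<delta> / 2" and d = "b - a"])
      (use second_short assms that in auto)
  then show ?thesis
    using exchanges_generate[OF H] by simp
qed

text \<open>An interval is moved to the right by \<open>d\<close> by swapping it with the interval of length \<open>d\<close> that
  follows it, and to the left likewise. This works even when it overlaps its target.\<close>

lemma transport_interval:
  assumes "p \<le> a" "a \<le> b" "b \<le> q" "p \<le> u" "v \<le> q" "b - a \<le> v - u"
  shows "\<exists>k\<in>carrier G. k ` {a..<b} \<subseteq> {u..<v}"
proof (cases "a \<le> u")
  case True
  then have "exchange a b (u + b - a) \<in> carrier G"
    using assms by (intro exchange_carrier) auto
  moreover have "exchange a b (u + b - a) ` {a..<b} \<subseteq> {u..<v}"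
    using assms True by (auto simp: exchange_def)
  ultimately show ?thesis by blast
next
  case False
  then have "exchange u a b \<in> carrier G"
    using assms by (intro exchange_carrier) auto
  moreover have "exchange u a b ` {a..<b} \<subseteq> {u..<v}"
    using assms False by (auto simp: exchange_def)
  ultimately show ?thesis by blast
qed

text \<open>On the piece of a moved point \<open>t\<close> the map is a translation by some \<open>c \<noteq> 0\<close>, so an interval starting
  at \<open>t\<close> of length at most \<open>\<bar>c\<bar>\<close> inside that piece is moved off itself.\<close>

lemma displaced_interval:
  assumes f: "f \<in> carrier G" "f \<noteq> \<one>"
  shows "\<exists>a b. p \<le> a \<and> a < b \<and> b \<le> q \<and> f ` {a..<b} \<inter> {a..<b} = {}"
proof -
  obtain t where t: "t \<in> {p..<q}" "f t \<noteq> t"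
    using carrier_eqI[OF f(1) one_closed] f(2) one_apply by auto
  obtain k :: nat and x where x: "x 0 = p" "x k = q" 
    and mono: "\<And>i j. \<lbrakk>i \<le> j; j \<le> k\<rbrakk> \<Longrightarrow> x i \<le> x j"
    and tr: "\<And>i. i < k \<Longrightarrow> \<exists>c. \<forall>t\<in>{x i..<x (Suc i)}. f t = t + c"
    using f(1) unfolding carrier_iff by (rule ietE) blast
  obtain i where i: "i < k" "x i \<le> t" "t < x (Suc i)"
    using chain_locate[of x t k] t x by auto
  obtain c where c: "\<And>s. s \<in> {x i..<x (Suc i)} \<Longrightarrow> f s = s + c"
    using tr[OF i(1)] by blast
  then have "c \<noteq> 0" using t(2) i by auto
  define b where "b = min (x (Suc i)) (t + \<bar>c\<bar>)"
  have "f ` {t..<b} \<inter> {t..<b} = {}"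
    using c i by (auto simp: b_def)
  moreover have "t < b" "b \<le> q"
    using i mono[of "Suc i" k] x \<open>c \<noteq> 0\<close> by (auto simp: b_def)
  ultimately show ?thesis using t by auto
qed

text \<open>The products on the right form a subgroup, because the commutator group is normal. It contains
  every \<open>s\<close> with short support: if \<open>k\<close> moves the support into \<open>{u..<v}\<close>, then
  \<open>s = [s, k] (k s k\<inverse>)\<close>.\<close>

lemma derived_times_supported:
  assumes "p \<le> u" "u < v" "v \<le> q" "h \<in> carrier G"
  shows "\<exists>d w. d \<in> derived G (carrier G) \<and> w \<in> supported {u..<v} \<and> h = d \<otimes> w"
proof -
  let ?D = "derived G (carrier G)" and ?P = "derived G (carrier G) <#> supported {u..<v}"
  have P: "subgroup ?P G"
    by (rule mult_norm_subgroup[OF derived_self_is_normal subgroup_supported])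
  have "short_supported (v - u) \<subseteq> ?P"
  proof
    fix s assume "s \<in> short_supported (v - u)"
    then obtain a b where ab: "p \<le> a" "a \<le> b" "b \<le> q" "b - a \<le> v - u"
      and s: "s \<in> supported {a..<b}"
      by (auto simp: short_supported_def)
    then obtain k where k: "k \<in> carrier G" "k ` {a..<b} \<subseteq> {u..<v}"
      using transport_interval assms by blast
    have "s \<in> carrier G" using s by (rule supported_carrier)
    then have "s = commutator G s k \<otimes> (k \<otimes> s \<otimes> inv k)" "commutator G s k \<in> ?D"
      using k(1) by (simp_all add: commutator_in_derived) (simp add: commutator_def m_assoc)
    moreover have "k \<otimes> s \<otimes> inv k \<in> supported {u..<v}"
      using s k by (intro supported_conj[of _ "{a..<b}"]) auto
    ultimately show "s \<in> ?P"
      unfolding set_mult_def by blast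
  qed
  then have "generate G (short_supported (v - u)) \<subseteq> ?P"
    using P by (rule generate_subgroup_incl)
  then have "h \<in> ?P"
    using short_supported_generate[of "v - u"] assms by auto
  then show ?thesis
    unfolding set_mult_def by blast
qed

section \<open>Simplicity\<close>

text \<open>If \<open>G'\<close> were trivial, correction in two disjoint intervals would put every element of \<open>G\<close> into two
  subgroups with disjoint supports, so \<open>G\<close> itself would be trivial. But the exchange of the two
  halves of \<open>{p..<q}\<close> moves \<open>p\<close>.\<close>

lemma derived_nontrivial: "derived G (carrier G) \<noteq> {\<one>}"
proof
  assume trivial: "derived G (carrier G) = {\<one>}"
  define m where "m = (p + q) / 2"
  have m: "p < m" "m < q" using p_less_q by (auto simp: m_def)
  let ?f = "exchange p m q"
  have f: "?f \<in> carrier G" using m by (intro exchange_carrier) auto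
  have "?f \<in> supported {p..<m}" "?f \<in> supported {m..<q}"
    using derived_times_supported[of p m ?f] derived_times_supported[of m q ?f] trivial m f
      supported_carrier by auto
  then have "?f p = p"
    using m by (simp add: supported_def)
  then show False using m by (simp add: exchange_def)
qed

text \<open>The subgroup \<open>N\<close> is normalized by \<open>G'\<close> only. Correction turns elements of \<open>G\<close> into elements of \<open>G'\<close>,
  both as entries of commutators (\<open>in_third\<close>) and as conjugating elements (\<open>conj_third\<close>).\<close>

lemma derived_subset_of_normal:
  assumes N: "N \<lhd> G\<lparr>carrier := derived G (carrier G)\<rparr>" and "N \<noteq> {\<one>}"
  shows "derived G (carrier G) \<subseteq> N"
proof -
  let ?D = "derived G (carrier G)"
  have D: "subgroup ?D G" by (rule derived_is_subgroup) simp
  then interpret D: subgroup ?D G .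
  interpret GD: group "G\<lparr>carrier := ?D\<rparr>" by (rule subgroup_imp_group[OF D])
  have N_D: "subgroup N (G\<lparr>carrier := ?D\<rparr>)"
    using N by (rule normal_imp_subgroup)
  have N_G: "subgroup N G"
    using D N_D by (rule incl_subgroup)
  interpret N: subgroup N G by (rule N_G)
  have N_conj: "x \<otimes> m \<otimes> inv x \<in> N" if "x \<in> ?D" "m \<in> N" for x m
  proof -
    have "x \<otimes> m \<otimes> inv\<^bsub>G\<lparr>carrier := ?D\<rparr>\<^esub> x \<in> N"
      using N that unfolding GD.normal_inv_iff by simp
    then show ?thesis
      unfolding m_inv_consistent[OF D that(1)] .
  qed
  obtain n where n: "n \<in> N" "n \<noteq> \<one>" using \<open>N \<noteq> {\<one>}\<close> N.one_closed by blast
  then obtain a b where ab: "p \<le> a" "a < b" "b \<le> q" and disp: "n ` {a..<b} \<inter> {a..<b} = {}"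
    using displaced_interval[of n] by auto
  define l where "l = (b - a) / 3"
  have l: "0 < l" "b = a + 3 * l" using ab by (auto simp: l_def field_simps)
  have in_third: "commutator G f g \<in> N"
    if f: "f \<in> supported {a..<a + l}" and g: "g \<in> supported {a..<a + l}" for f g
  proof -
    have fg: "f \<in> carrier G" "g \<in> carrier G" using f g supported_carrier by auto
    obtain f' u where f': "f' \<in> ?D" "u \<in> supported {a + l..<a + 2 * l}" "f = f' \<otimes> u"
      using derived_times_supported[of "a + l" "a + 2 * l" f] fg ab l by auto
    obtain g' v where g': "g' \<in> ?D" "v \<in> supported {a + 2 * l..<b}" "g = g' \<otimes> v"
      using derived_times_supported[of "a + 2 * l" b g] fg ab l by auto
    have carr: "f' \<in> carrier G" "g' \<in> carrier G" "u \<in> carrier G" "v \<in> carrier G"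
      using f' g' supported_carrier by auto
    have f'_eq: "f' = f \<otimes> inv u" and g'_eq: "g' = g \<otimes> inv v"
      using f'(3) g'(3) carr by (simp_all add: m_assoc)
    have iu: "inv u \<in> supported {a + l..<a + 2 * l}" and iv: "inv v \<in> supported {a + 2 * l..<b}"
      using f'(2) g'(2) subgroup.m_inv_closed[OF subgroup_supported] by auto
    have g'_supp: "g' \<in> supported ({a..<a + l} \<union> {a + 2 * l..<b})"
      unfolding g'_eq
      by (intro subgroup.m_closed[OF subgroup_supported])
        (use g iv in \<open>auto elim: supported_mono\<close>)
    have f'_supp: "f' \<in> supported {a..<b}"
      unfolding f'_eq
      by (intro subgroup.m_closed[OF subgroup_supported] supported_mono[OF f] supported_mono[OF iu])
        (use l in auto)
    have "commutator G f' g' = commutator G f g'"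
      unfolding f'_eq
      by (intro commutator_mult_left_commuting supported_disjoint_commute[OF iu g'_supp])
        (use fg carr l in auto)
    also have "\<dots> = commutator G f g"
      unfolding g'_eq
      by (intro commutator_mult_right_commuting supported_disjoint_commute[OF iv f])
        (use fg carr l in auto)
    finally have "commutator G f g = commutator G f' g'" ..
    moreover have "commutator G f' g' \<in> N"
    proof (rule commutator_in_normal_of_displacement[OF D.subset N_G N_conj n(1) f'(1) g'(1)])
      have "n \<otimes> inv f' \<otimes> inv n \<in> supported (n ` {a..<b})"
        by (rule supported_conj[of _ "{a..<b}"])
          (use f'_supp subgroup.m_inv_closed[OF subgroup_supported] n in auto)
      moreover have "g' \<in> supported {a..<b}"
        by (rule supported_mono[OF g'_supp]) (use l in auto)
      ultimately show "n \<otimes> inv f' \<otimes> inv n \<otimes> g' = g' \<otimes> (n \<otimes> inv f' \<otimes> inv n)"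
        using disp by (rule supported_disjoint_commute)
    qed
    ultimately show ?thesis by simp
  qed
  have conj_third: "h \<otimes> commutator G f g \<otimes> inv h \<in> N"
    if f: "f \<in> supported {a..<a + l}" and g: "g \<in> supported {a..<a + l}" and h: "h \<in> carrier G" for f g h
  proof -
    let ?c = "commutator G f g"
    obtain d w where d: "d \<in> ?D" "w \<in> supported {a + l..<b}" "h = d \<otimes> w"
      using derived_times_supported[of "a + l" b h] h ab l by auto
    have carr: "f \<in> carrier G" "g \<in> carrier G" "d \<in> carrier G" "w \<in> carrier G"
      using d f g supported_carrier by auto
    interpret third: subgroup "supported {a..<a + l}" G by (rule subgroup_supported)
    have "?c \<in> supported {a..<a + l}"
      using f g unfolding commutator_def by simp
    then have wc: "w \<otimes> ?c = ?c \<otimes> w"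
      using d(2) by (intro supported_disjoint_commute) auto
    have "h \<otimes> ?c \<otimes> inv h = d \<otimes> (w \<otimes> ?c) \<otimes> inv w \<otimes> inv d"
      using carr by (simp add: d(3) inv_mult_group m_assoc)
    also have "\<dots> = d \<otimes> ?c \<otimes> inv d"
      unfolding wc using carr by (simp add: m_assoc)
    also have "\<dots> \<in> N"
      using d(1) in_third[OF f g] by (rule N_conj)
    finally show ?thesis .
  qed
  have conj_short: "h \<otimes> commutator G f g \<otimes> inv h \<in> N"
    if J: "p \<le> c" "c \<le> e" "e \<le> q" "e - c \<le> l"
      and f: "f \<in> supported {c..<e}" and g: "g \<in> supported {c..<e}" and h: "h \<in> carrier G" for c e f g h
  proof -
    obtain k where k: "k \<in> carrier G" "k ` {c..<e} \<subseteq> {a..<a + l}"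
      using transport_interval[of c e a "a + l"] J ab l by auto
    have carr: "f \<in> carrier G" "g \<in> carrier G" using f g supported_carrier by auto
    have "k \<otimes> f \<otimes> inv k \<in> supported {a..<a + l}" "k \<otimes> g \<otimes> inv k \<in> supported {a..<a + l}"
      using k(2) by (auto intro!: supported_conj[OF f k(1)] supported_conj[OF g k(1)])
    \<comment> \<open>The commutator is moved into the third by \<open>k\<close>, which the conjugating element undoes.\<close>
    then have "(h \<otimes> inv k) \<otimes> (k \<otimes> commutator G f g \<otimes> inv k) \<otimes> inv (h \<otimes> inv k) \<in> N"
      unfolding conj_commutator[OF carr k(1)] using h k(1) by (intro conj_third) auto
    then show ?thesis
      using h k(1) carr by (simp add: inv_mult_group m_assoc)
  qed
  show ?thesis
  proof (rule derived_subset_of_commutator_conjugates[OF N_G short_supported_generate])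
    \<comment> \<open>Two overlapping intervals of length at most \<open>l / 2\<close> have a union of length at most \<open>l\<close>.\<close>
    show "0 < l / 2" using l by simp
    fix h f g assume h: "h \<in> carrier G"
      and fg: "f \<in> short_supported (l / 2)" "g \<in> short_supported (l / 2)"
    obtain c e where f: "p \<le> c" "c \<le> e" "e \<le> q" "e - c \<le> l / 2" "f \<in> supported {c..<e}"
      using fg by (auto simp: short_supported_def)
    obtain c' e' where g: "p \<le> c'" "c' \<le> e'" "e' \<le> q" "e' - c' \<le> l / 2" "g \<in> supported {c'..<e'}"
      using fg by (auto simp: short_supported_def)
    show "h \<otimes> commutator G f g \<otimes> inv h \<in> N"
    proof (cases "{c..<e} \<inter> {c'..<e'} = {}")
      case True
      then have "commutator G f g = \<one>"
        using f g supported_disjoint_commute supported_carrier by (intro commutator_eq_one) blast+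
      then show ?thesis using h by simp
    next
      case False
      show ?thesis
      proof (rule conj_short[of "min c c'" "max e e'"])
        show "f \<in> supported {min c c'..<max e e'}" "g \<in> supported {min c c'..<max e e'}"
          using supported_mono[OF f(5)] supported_mono[OF g(5)] by auto
      qed (use False f g h in \<open>auto simp: min_def max_def\<close>)
    qed
  qed
qed

end

theorem theorem1p3:
  fixes p q :: real
  assumes "p < q"
  shows "is_simple (commutator_group (iet_group p q))"
proof -
  interpret group "iet_group p q"
    unfolding iet_group_def
    by (rule group.subgroup_imp_group[OF group_BijGroup subgroup_iet[OF assms]])
  interpret interval_exchange "iet_group p q" p q
    using assms by unfold_locales auto
  let ?G = "iet_group p q" and ?D = "derived (iet_group p q) (carrier (iet_group p q))"
  have D: "subgroup ?D ?G" by (rule derived_is_subgroup) simp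
  show ?thesis
    unfolding is_simple_def
  proof (intro conjI allI impI)
    show "Group.group (commutator_group ?G)"
      unfolding commutator_group_def by (rule subgroup_imp_group[OF D])
    show "carrier (commutator_group ?G) \<noteq> {\<one>\<^bsub>commutator_group ?G\<^esub>}"
      using derived_nontrivial by (simp add: commutator_group_def)
    fix N assume N: "N \<lhd> commutator_group ?G"
    have "N \<subseteq> ?D"
      using subgroup.subset[OF normal_imp_subgroup[OF N]] by (simp add: commutator_group_def)
    then show "N = carrier (commutator_group ?G) \<or> N = {\<one>\<^bsub>commutator_group ?G\<^esub>}"
      using derived_subset_of_normal[of N] N by (auto simp: commutator_group_def)
  qed
qed

end
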